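(* Let $n,m\ge 1$, let $g_1,\ldots,g_m$ be computable functions from $\mathbb{Z}^{n+1}$ to $\mathbb{Z}^n$, and let $PROG=(S,I,R)$ be the while-loop program with variables $x[1],\ldots,x[n]$ determined by $g_1,\ldots,g_m$. Assume that for each computational segment $t_1,\ldots,t_L$ with $L\ge 2$ there exists $k$ with $1\le k\le n$ such that the value of $x[k]$ in $t_L$ is strictly less than the value of $x[k]$ in $t_1$. Then any computation of $PROG$ is finite.
   Context: The while-loop program determined by $g_1,\ldots,g_m:\mathbb{Z}^{n+1}\to\mathbb{Z}^n$ is the following. The state is $X=(x[1],\ldots,x[n])\in\mathbb{Z}^n$; initially $X$ is an arbitrary element of $\mathbb{Z}^n$ supplied by the user. While $x[1]>0$ and $x[2]>0$ and $\cdots$ and $x[n]>0$, the user chooses $\mathrm{control}=i\in\{1,\ldots,m\}$ and an integer $u\in\mathbb{Z}$, and $X$ is replaced by $g_i(X,u)$. Formally $S=I=\mathbb{Z}^n$, and $R(s,t)$ holds iff all coordinates of $s$ are positive and there exist $i\in\{1,\ldots,m\}$ and $u\in\mathbb{Z}$ with $t=g_i(s,u)$. A computation is a finite or infinite sequence of states $s_1,s_2,\ldots$ with $s_1\in I$, with $R(s_i,s_{i+1})$ for all consecutive terms, and such that if the sequence is finite with last state $s$ then there is no $t$ with $R(s,t)$. A computational segment is a finite sequence of states $t_1,\ldots,t_L$ such that $R(t_i,t_{i+1})$ for all $1\le i\le L-1$ (it is not required that $t_1\in I$ or that $t_L$ be terminal). *)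

theory Defs
  imports Main "HOL-Library.Nat_Bijection" "HOL-Library.Extended_Nat"
begin

text \<open>
  Computability on natural numbers is given by Kleene's partial recursive functions.  Descriptions
  carry no arity: the arguments are a list, and \<open>evaluates\<close> holds only where the
  argument list has the shape required by the description.
\<close>

datatype recf =
    Zero
  | Succ
  | Proj nat
  | Comp recf "recf list"
  | Prec recf recf
  | Mu recf

inductive evaluates :: "recf \<Rightarrow> nat list \<Rightarrow> nat \<Rightarrow> bool" where
  Zero: "evaluates Zero xs 0"
| Succ: "evaluates Succ [x] (Suc x)"
| Proj: "i < length xs \<Longrightarrow> evaluates (Proj i) xs (xs ! i)"
| Comp: "list_all2 (\<lambda>h y. evaluates h xs y) hs ys \<Longrightarrow> evaluates f ys z \<Longrightarrow>
    evaluates (Comp f hs) xs z"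
| Prec_0: "evaluates f xs y \<Longrightarrow> evaluates (Prec f h) (0 # xs) y"
| Prec_Suc: "evaluates (Prec f h) (k # xs) r \<Longrightarrow> evaluates h (k # r # xs) y \<Longrightarrow>
    evaluates (Prec f h) (Suc k # xs) y"
| Mu: "evaluates f (y # xs) 0 \<Longrightarrow> \<forall>z<y. \<exists>r. evaluates f (z # xs) (Suc r) \<Longrightarrow>
    evaluates (Mu f) xs y"

inductive_cases evaluates_ZeroE: "evaluates Zero xs y"
inductive_cases evaluates_SuccE: "evaluates Succ xs y"
inductive_cases evaluates_ProjE: "evaluates (Proj i) xs y"
inductive_cases evaluates_CompE: "evaluates (Comp f hs) xs y"
inductive_cases evaluates_Prec_0E: "evaluates (Prec f h) (0 # xs) y"
inductive_cases evaluates_Prec_SucE: "evaluates (Prec f h) (Suc k # xs) y"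
inductive_cases evaluates_MuE: "evaluates (Mu f) xs y"

lemma evaluates_deterministic:
  "evaluates f xs y \<Longrightarrow> evaluates f xs y' \<Longrightarrow> y' = y"
proof (induction arbitrary: y' rule: evaluates.induct)
  case (Comp xs hs ys f z)
  from Comp.prems obtain ys' where ys': "list_all2 (\<lambda>h y. evaluates h xs y) hs ys'"
    and z': "evaluates f ys' y'"
    by (rule evaluates_CompE)
  have len: "length ys' = length ys"
    using list_all2_lengthD[OF Comp.IH(1)] list_all2_lengthD[OF ys'] by linarith
  have "ys' = ys"
  proof (rule nth_equalityI[OF len])
    fix i assume "i < length ys'"
    then have i: "i < length hs" using list_all2_lengthD[OF ys'] by linarith
    show "ys' ! i = ys ! i"
      using list_all2_nthD[OF Comp.IH(1) i] list_all2_nthD[OF ys' i] by blast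
  qed
  with z' have "evaluates f ys y'" by simp
  then show ?case by (rule Comp.IH(2))
next
  case (Mu f y xs)
  have 1: "evaluates f (y' # xs) 0"
    using Mu.prems by (rule evaluates_MuE)
  have 2: "\<forall>z<y'. \<exists>r. evaluates f (z # xs) (Suc r)"
    using Mu.prems by (rule evaluates_MuE)
  have "\<not> y' < y"
  proof
    assume "y' < y"
    with Mu.IH(2) obtain r where "\<And>w. evaluates f (y' # xs) w \<Longrightarrow> w = Suc r" by blast
    from this[OF 1] show False by simp
  qed
  moreover have "\<not> y < y'"
  proof
    assume "y < y'"
    with 2 obtain r where "evaluates f (y # xs) (Suc r)" by blast
    from Mu.IH(1)[OF this] show False by simp
  qed
  ultimately show ?case by simp
next
  case (Prec_Suc f h k xs r y)
  from Prec_Suc.prems obtain r' where r': "evaluates (Prec f h) (k # xs) r'"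
    and y': "evaluates h (k # r' # xs) y'"
    by (rule evaluates_Prec_SucE)
  from y' show ?case unfolding Prec_Suc.IH(1)[OF r'] by (rule Prec_Suc.IH(2))
next
  case (Zero xs)
  then show ?case by (rule evaluates_ZeroE)
next
  case (Succ x)
  then show ?case by (rule evaluates_SuccE) simp
next
  case (Proj i xs)
  from Proj.prems show ?case by (rule evaluates_ProjE)
next
  case (Prec_0 f xs y h)
  from Prec_0.prems have "evaluates f xs y'" by (rule evaluates_Prec_0E)
  then show ?case by (rule Prec_0.IH)
qed

text \<open>
  \<open>\<int>\<^sup>p\<close> is the set of integer lists of length \<open>p\<close>.
  A map \<open>\<int>\<^sup>p \<rightarrow> \<int>\<^sup>q\<close> is computable iff each of its \<open>q\<close> components is a (total) recursive function
  under the standard coding \<open>int_encode\<close> of integers as naturals.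
\<close>

definition int_vecs :: "nat \<Rightarrow> int list set" where
  "int_vecs p = {v. length v = p}"

definition computable_map :: "nat \<Rightarrow> nat \<Rightarrow> (int list \<Rightarrow> int list) \<Rightarrow> bool" where
  "computable_map p q F \<longleftrightarrow>
     (\<forall>v\<in>int_vecs p. F v \<in> int_vecs q) \<and>
     (\<forall>j<q. \<exists>f. \<forall>v\<in>int_vecs p. evaluates f (map int_encode v) (int_encode (F v ! j)))"

record 'a program =
  states :: "'a set"
  initial :: "'a set"
  trans_rel :: "'a \<Rightarrow> 'a \<Rightarrow> bool"

text \<open>
  The argument \<open>(X, u)\<close> of \<open>g i\<close> is the list \<open>X @ [u]\<close>, and the variable \<open>x[k]\<close> of a state \<open>s\<close>
  is \<open>s ! (k - 1)\<close>.
\<close>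

definition while_program :: "nat \<Rightarrow> nat \<Rightarrow> (nat \<Rightarrow> int list \<Rightarrow> int list) \<Rightarrow> int list program" where
  "while_program n m g =
     \<lparr>states = int_vecs n,
      initial = int_vecs n,
      trans_rel = (\<lambda>s t. s \<in> int_vecs n \<and> t \<in> int_vecs n \<and> (\<forall>k\<in>{1..n}. s ! (k - 1) > 0) \<and>
        (\<exists>i\<in>{1..m}. \<exists>u. t = g i (s @ [u])))\<rparr>"

text \<open>
  A finite or infinite sequence is a pair of its length \<open>N\<close> and a function \<open>s\<close> of which only the
  values below \<open>N\<close> matter; the terms are \<open>s 0, s 1, \<dots>\<close>.
\<close>

definition computation :: "'a program \<Rightarrow> enat \<Rightarrow> (nat \<Rightarrow> 'a) \<Rightarrow> bool" where
  "computation P N s \<longleftrightarrow>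
     N \<noteq> 0 \<and>
     (\<forall>i. enat i < N \<longrightarrow> s i \<in> states P) \<and>
     s 0 \<in> initial P \<and>
     (\<forall>i. enat (Suc i) < N \<longrightarrow> trans_rel P (s i) (s (Suc i))) \<and>
     (\<forall>i. N = enat (Suc i) \<longrightarrow> \<not> (\<exists>t\<in>states P. trans_rel P (s i) t))"

definition computational_segment :: "'a program \<Rightarrow> 'a list \<Rightarrow> bool" where
  "computational_segment P ts \<longleftrightarrow>
     set ts \<subseteq> states P \<and>
     (\<forall>i. Suc i < length ts \<longrightarrow> trans_rel P (ts ! i) (ts ! Suc i))"

end

theory Submission
  imports Defs "HOL-Library.Ramsey"
begin

text \<open>
  In an infinite computation all states are positive, and every pair \<open>i < j\<close> of positions bounds a
  segment, so some coordinate decreases from \<open>i\<close> to \<open>j\<close>. Colouring each pair with such a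
  coordinate covers the transitive relation \<open>j > i\<close> by finitely many well-founded relations, so by
  Ramsey's theorem this relation is itself well-founded, which is absurd.
\<close>

lemma computational_segment_of_computation:
  assumes "computation P \<infinity> s"
  shows "computational_segment P (map s [i..<j])"
  using assms by (auto simp: computation_def computational_segment_def)

lemma no_sequence_decreasing_somewhere:
  fixes f :: "nat \<Rightarrow> nat \<Rightarrow> nat"
  assumes dec: "\<And>i j. i < j \<Longrightarrow> \<exists>k<n. f j k < f i k"
  shows False
proof -
  \<comment> \<open>The later position comes first in each pair, so descent in these relations means
    moving forward in time.\<close>
  define T where "T k = {(j, i). i < j \<and> f j k < f i k}" for k
  let ?r = "{(j, i). i < (j::nat)}"
  have "wf (T k)" for k
    by (rule wf_subset[OF wf_measure[of "\<lambda>i. f i k"]]) (auto simp: T_def)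
  moreover have "?r = (\<Union>k<n. T k)"
    using dec by (auto simp: T_def)
  ultimately have "disj_wf ?r"
    unfolding disj_wf_def by blast
  moreover have "trans ?r"
    by (auto intro: transI)
  ultimately have "wf ?r"
    by (rule trans_disj_wf_implies_wf[rotated])
  \<comment> \<open>The sequence 0, 1, 2, ... is itself an infinite descending chain of
    \<open>?r\<close>.\<close>
  then show False
    unfolding wf_iff_no_infinite_down_chain by (metis case_prodI lessI mem_Collect_eq)
qed

theorem theorem7p1:
  fixes n m :: nat and g :: "nat \<Rightarrow> int list \<Rightarrow> int list"
  assumes "n \<ge> 1" and "m \<ge> 1"
    and "\<And>i. i \<in> {1..m} \<Longrightarrow> computable_map (n + 1) n (g i)"
    and "\<And>ts. computational_segment (while_program n m g) ts \<Longrightarrow> length ts \<ge> 2 \<Longrightarrow>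
           \<exists>k\<in>{1..n}. last ts ! (k - 1) < hd ts ! (k - 1)"
  shows "\<forall>N s. computation (while_program n m g) N s \<longrightarrow> N \<noteq> \<infinity>"
proof (intro allI impI notI)
  fix N s
  assume "computation (while_program n m g) N s" and "N = \<infinity>"
  then have comp: "computation (while_program n m g) \<infinity> s"
    by simp
  \<comment> \<open>Every state of an infinite computation has a successor, so the loop guard holds
    there.\<close>
  then have pos: "s i ! (k - 1) > 0" if "k \<in> {1..n}" for i k
    using that by (auto simp: computation_def while_program_def)
  show False
  proof (rule no_sequence_decreasing_somewhere)
    fix i j :: nat
    assume "i < j"
    let ?ts = "map s [i..<Suc j]"
    have "hd ?ts = s i" "last ?ts = s j" "length ?ts \<ge> 2"
      using \<open>i < j\<close> by (auto simp: hd_map simp del: upt_Suc) (simp add: last_map)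
    then obtain k where k: "k \<in> {1..n}" "s j ! (k - 1) < s i ! (k - 1)"
      using assms(4)[OF computational_segment_of_computation[OF comp, of i "Suc j"]] by auto
    \<comment> \<open>\<open>nat\<close> sends negative values to 0; the decrease stays strict
      because the earlier value is positive.\<close>
    have "nat (s j ! (k - 1)) < nat (s i ! (k - 1))"
      using k pos[of k i] by simp
    then show "\<exists>k<n. nat (s j ! k) < nat (s i ! k)"
      using k(1) by (intro exI[of _ "k - 1"]) auto
  qed
qed

end
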